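(* Let $\alpha,\beta,w\in\mathbb{C}$, $\gamma\in\mathbb{C}\setminus\{0,-1,-2,\ldots\}$, $k\in(0,1)$, and let $\delta:=\beta+1$. For integers $0\le m\le n$ define $\tilde{f}_{m,n}:=1$ if $m=0$, and, if $m\ge1$, $$\tilde{f}_{m,n}:=(-1)^{m}\sum_{0\leq\ell_{1}\leq j_{1}<\ell_{2}\leq j_{2}<\cdots<\ell_{m}\leq j_{m}<n}\ \prod_{s=1}^{m}\frac{j_{s}!\,(\alpha)_{j_{s}}(\beta)_{\ell_{s}}(\gamma)_{\ell_{s}}}{\ell_{s}!\,(\alpha)_{\ell_{s}}(\beta)_{j_{s}+1}(\gamma)_{j_{s}+1}}\,k^{2(j_{s}-\ell_{s})},$$ where the sum runs over all integers $j_1,\dots,j_m,\ell_1,\dots,\ell_m$ satisfying the indicated inequalities. Then the function $$\tilde{F}(z):=\sum_{n=0}^{\infty}\sum_{m=0}^{n}\frac{(\beta)_{n}}{n!}\,\tilde{f}_{m,n}\,w^{m}z^{n},\qquad z\in D_{1}=\{z\in\mathbb{C}:|z|<1\},$$ is the local Heun solution $$\tilde{F}(z)=\mathrm{H}\ell\Big(\frac{1}{k^{2}},-\frac{w-\beta\gamma}{k^{2}};\alpha,\beta,\gamma,\beta+1;z\Big).$$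
   Context: $(x)_n:=x(x+1)\cdots(x+n-1)$ is the Pochhammer symbol, with $(x)_0=1$. Local Heun solution: for $a,q,\alpha,\beta,\gamma,\delta\in\mathbb{C}$ with $|a|>1$ and $\gamma\notin\{0,-1,-2,\ldots\}$, put $\epsilon:=\alpha+\beta+1-\gamma-\delta$. Then $\mathrm{H}\ell(a,q;\alpha,\beta,\gamma,\delta;z)$ denotes the unique function $F$ analytic in the unit disk $D_1$ with $F(0)=1$ that solves Heun's equation $$F''(z)+\left(\frac{\gamma}{z}+\frac{\delta}{z-1}+\frac{\epsilon}{z-a}\right)F'(z)+\frac{\alpha\beta z-q}{z(z-1)(z-a)}F(z)=0.$$ Conventions for degenerate parameters: for $0\le\ell\le j$ the ratio $(\alpha)_j/(\alpha)_\ell$ is understood as the polynomial $(\alpha+\ell)(\alpha+\ell+1)\cdots(\alpha+j-1)$. If $\beta$ is a non-positive integer, the product $(\beta)_n\tilde f_{m,n}$ is understood after cancellation of common factors: for $0\leq\ell_{1}\leq j_{1}<\cdots<\ell_{m}\leq j_{m}<n$ the expression $(\beta)_{n}\prod_{s=1}^{m}\frac{(\beta)_{\ell_{s}}}{(\beta)_{j_{s}+1}}$ is the polynomial in $\beta$ equal to the product of $(\beta+i)$ over those $i\in\{0,\dots,n-1\}$ not lying in any of the intervals $[\ell_s,j_s]$. *)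

theory Defs
  imports "HOL-Analysis.Analysis"
begin

text \<open>Heun's equation is required off \<open>z = 0\<close>, its only singular point in the unit
  disk when \<open>norm a > 1\<close>. At that point Isabelle's \<open>x / 0 = 0\<close> would impose a
  spurious condition.\<close>

definition is_local_heun ::
  "complex \<Rightarrow> complex \<Rightarrow> complex \<Rightarrow> complex \<Rightarrow> complex \<Rightarrow> complex \<Rightarrow> (complex \<Rightarrow> complex) \<Rightarrow> bool" where
  "is_local_heun a q \<alpha> \<beta> \<gamma> \<delta> F \<longleftrightarrow>
     F analytic_on ball 0 1 \<and> F 0 = 1 \<and>
     (let \<epsilon> = \<alpha> + \<beta> + 1 - \<gamma> - \<delta> in
      \<forall>z\<in>ball 0 1 - {0}.
        deriv (deriv F) z + (\<gamma> / z + \<delta> / (z - 1) + \<epsilon> / (z - a)) * deriv F z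
          + (\<alpha> * \<beta> * z - q) / (z * (z - 1) * (z - a)) * F z = 0)"

text \<open>HOL functions are total, so the solution on the unit disk is made unique by the value
  \<open>0\<close> outside. The description is meaningful for \<open>norm a > 1\<close> and
  \<open>\<gamma> \<notin> {0, -1, -2, \<dots>}\<close>.\<close>

definition heun_local ::
  "complex \<Rightarrow> complex \<Rightarrow> complex \<Rightarrow> complex \<Rightarrow> complex \<Rightarrow> complex \<Rightarrow> complex \<Rightarrow> complex" where
  "heun_local a q \<alpha> \<beta> \<gamma> \<delta> =
     (THE F. is_local_heun a q \<alpha> \<beta> \<gamma> \<delta> F \<and> (\<forall>z. z \<notin> ball 0 1 \<longrightarrow> F z = 0))"

text \<open>The tuples \<open>0 \<le> l 1 \<le> j 1 < l 2 \<le> j 2 < \<dots> < l m \<le> j m < n\<close>, as extensional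
  functions on \<open>{1..m}\<close>.\<close>

definition interval_chains :: "nat \<Rightarrow> nat \<Rightarrow> ((nat \<Rightarrow> nat) \<times> (nat \<Rightarrow> nat)) set" where
  "interval_chains m n = {(l, j). l \<in> {1..m} \<rightarrow>\<^sub>E {..<n} \<and> j \<in> {1..m} \<rightarrow>\<^sub>E {..<n} \<and>
     (\<forall>s\<in>{1..m}. l s \<le> j s) \<and> (\<forall>s\<in>{1..<m}. j s < l (s + 1))}"

text \<open>The factor \<open>pochhammer (\<alpha> + l s) (j s - l s)\<close> is the polynomial reading of
  \<open>pochhammer \<alpha> (j s) / pochhammer \<alpha> (l s)\<close>.\<close>

definition heun_f :: "complex \<Rightarrow> complex \<Rightarrow> complex \<Rightarrow> real \<Rightarrow> nat \<Rightarrow> nat \<Rightarrow> complex" where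
  "heun_f \<alpha> \<beta> \<gamma> k m n =
     (if m = 0 then 1
      else (-1) ^ m * (\<Sum>(l, j)\<in>interval_chains m n. \<Prod>s=1..m.
        (fact (j s) * pochhammer (\<alpha> + of_nat (l s)) (j s - l s)
           * pochhammer \<beta> (l s) * pochhammer \<gamma> (l s))
        / (fact (l s) * pochhammer \<beta> (j s + 1) * pochhammer \<gamma> (j s + 1))
        * of_real k ^ (2 * (j s - l s))))"

text \<open>The product \<open>pochhammer \<beta> n * heun_f \<alpha> \<beta> \<gamma> k m n\<close> after cancellation of the
  factors \<open>\<beta> + i\<close> with \<open>i\<close> in one of the intervals \<open>{l s..j s}\<close>.\<close>

definition heun_f_cancelled :: "complex \<Rightarrow> complex \<Rightarrow> complex \<Rightarrow> real \<Rightarrow> nat \<Rightarrow> nat \<Rightarrow> complex" where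
  "heun_f_cancelled \<alpha> \<beta> \<gamma> k m n =
     (if m = 0 then pochhammer \<beta> n
      else (-1) ^ m * (\<Sum>(l, j)\<in>interval_chains m n.
        (\<Prod>i\<in>{..<n} - (\<Union>s\<in>{1..m}. {l s..j s}). \<beta> + of_nat i) *
        (\<Prod>s=1..m.
          (fact (j s) * pochhammer (\<alpha> + of_nat (l s)) (j s - l s) * pochhammer \<gamma> (l s))
          / (fact (l s) * pochhammer \<gamma> (j s + 1))
          * of_real k ^ (2 * (j s - l s)))))"

definition heun_coeff :: "complex \<Rightarrow> complex \<Rightarrow> complex \<Rightarrow> real \<Rightarrow> nat \<Rightarrow> nat \<Rightarrow> complex" where
  "heun_coeff \<alpha> \<beta> \<gamma> k m n =
     (if \<beta> \<in> \<int>\<^sub>\<le>\<^sub>0 then heun_f_cancelled \<alpha> \<beta> \<gamma> k m n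
      else pochhammer \<beta> n * heun_f \<alpha> \<beta> \<gamma> k m n)"

definition heun_summand ::
  "complex \<Rightarrow> complex \<Rightarrow> complex \<Rightarrow> real \<Rightarrow> complex \<Rightarrow> complex \<Rightarrow> nat \<Rightarrow> complex" where
  "heun_summand \<alpha> \<beta> \<gamma> k w z n =
     (\<Sum>m=0..n. heun_coeff \<alpha> \<beta> \<gamma> k m n / fact n * w ^ m * z ^ n)"

definition heun_F ::
  "complex \<Rightarrow> complex \<Rightarrow> complex \<Rightarrow> real \<Rightarrow> complex \<Rightarrow> complex \<Rightarrow> complex" where
  "heun_F \<alpha> \<beta> \<gamma> k w z = (\<Sum>n. heun_summand \<alpha> \<beta> \<gamma> k w z n)"


lemma interval_chains_less:
  assumes c: "(l, j) \<in> interval_chains m n" and "1 \<le> s" "s < t" "t \<le> m"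
  shows "j s < l t"
  using \<open>s < t\<close> \<open>t \<le> m\<close>
proof (induction t)
  case 0
  then show ?case by simp
next
  case (Suc t)
  show ?case
  proof (cases "s = t")
    case True
    then show ?thesis using c Suc.prems \<open>1 \<le> s\<close> by (auto simp: interval_chains_def)
  next
    case False
    then have "j s < l t" using Suc by simp
    also have "l t \<le> j t" using c Suc.prems \<open>1 \<le> s\<close> by (auto simp: interval_chains_def)
    also have "j t < l (Suc t)" using c Suc.prems False \<open>1 \<le> s\<close> by (auto simp: interval_chains_def)
    finally show ?thesis .
  qed
qed

lemma pochhammer_split_prod:
  fixes b :: complex
  assumes "l \<le> j"
  shows "pochhammer b (j + 1) = pochhammer b l * (\<Prod>i=l..j. b + of_nat i)"
proof -
  have "{0..<j + 1} = {0..<l} \<union> {l..j}" using assms by auto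
  moreover have "(\<Prod>i\<in>{0..<l} \<union> {l..j}. b + of_nat i)
      = (\<Prod>i\<in>{0..<l}. b + of_nat i) * (\<Prod>i=l..j. b + of_nat i)"
    by (rule prod.union_disjoint) auto
  ultimately show ?thesis by (simp only: pochhammer_prod)
qed

text \<open>The two readings agree when both make sense.\<close>

lemma heun_f_cancelled_eq:
  assumes b: "\<beta> \<notin> \<int>\<^sub>\<le>\<^sub>0"
  shows "heun_f_cancelled \<alpha> \<beta> \<gamma> k m n = pochhammer \<beta> n * heun_f \<alpha> \<beta> \<gamma> k m n"
proof -
  have nz: "\<beta> + of_nat i \<noteq> 0" for i
    using b plus_of_nat_eq_0_imp by blast
  have pnz: "pochhammer \<beta> i \<noteq> 0" for i
    using nz by (simp add: pochhammer_prod)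
  have key: "(\<Prod>i\<in>{..<n} - (\<Union>s\<in>{1..m}. {l s..j s}). \<beta> + of_nat i)
      = pochhammer \<beta> n * (\<Prod>s=1..m. pochhammer \<beta> (l s) / pochhammer \<beta> (j s + 1))"
    if c: "(l, j) \<in> interval_chains m n" for l j
  proof -
    let ?U = "\<Union>s\<in>{1..m}. {l s..j s}"
    have lj: "l s \<le> j s" and jn: "j s < n" if "s \<in> {1..m}" for s
      using c that by (auto simp: interval_chains_def PiE_def Pi_def)
    have sub: "?U \<subseteq> {..<n}"
      using jn by fastforce
    have dis: "{l s..j s} \<inter> {l t..j t} = {}" if "s \<in> {1..m}" "t \<in> {1..m}" "s \<noteq> t" for s t
      using interval_chains_less[OF c, of s t] interval_chains_less[OF c, of t s] that
      by (cases "s < t") auto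
    have "(\<Prod>s=1..m. pochhammer \<beta> (l s) / pochhammer \<beta> (j s + 1))
        = (\<Prod>s=1..m. inverse (\<Prod>i=l s..j s. \<beta> + of_nat i))"
      by (intro prod.cong refl, subst pochhammer_split_prod[OF lj])
         (use pnz in \<open>simp_all add: field_simps\<close>)
    also have "\<dots> = inverse (\<Prod>s=1..m. \<Prod>i=l s..j s. \<beta> + of_nat i)"
      by (simp add: prod_inversef[symmetric] o_def)
    also have "(\<Prod>s=1..m. \<Prod>i=l s..j s. \<beta> + of_nat i) = (\<Prod>i\<in>?U. \<beta> + of_nat i)"
      by (rule prod.UNION_disjoint[symmetric]) (use dis in auto)
    finally have 1: "(\<Prod>s=1..m. pochhammer \<beta> (l s) / pochhammer \<beta> (j s + 1))
        = inverse (\<Prod>i\<in>?U. \<beta> + of_nat i)" .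
    have 2: "pochhammer \<beta> n = (\<Prod>i\<in>{..<n} - ?U. \<beta> + of_nat i) * (\<Prod>i\<in>?U. \<beta> + of_nat i)"
      using prod.subset_diff[OF sub, of "\<lambda>i. \<beta> + of_nat i"]
      by (simp add: pochhammer_prod atLeast0LessThan)
    have "(\<Prod>i\<in>?U. \<beta> + of_nat i) \<noteq> 0"
      using nz by (simp add: prod_zero_iff)
    then show ?thesis unfolding 1 2 by (simp add: field_simps)
  qed
  show ?thesis
  proof (cases "m = 0")
    case True
    then show ?thesis by (simp add: heun_f_def heun_f_cancelled_def)
  next
    case False
    have "(\<Prod>i\<in>{..<n} - (\<Union>s\<in>{1..m}. {l s..j s}). \<beta> + of_nat i) *
        (\<Prod>s=1..m.
          (fact (j s) * pochhammer (\<alpha> + of_nat (l s)) (j s - l s) * pochhammer \<gamma> (l s))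
          / (fact (l s) * pochhammer \<gamma> (j s + 1)) * of_real k ^ (2 * (j s - l s)))
      = pochhammer \<beta> n * (\<Prod>s=1..m.
        (fact (j s) * pochhammer (\<alpha> + of_nat (l s)) (j s - l s)
           * pochhammer \<beta> (l s) * pochhammer \<gamma> (l s))
        / (fact (l s) * pochhammer \<beta> (j s + 1) * pochhammer \<gamma> (j s + 1))
        * of_real k ^ (2 * (j s - l s)))" if c: "(l, j) \<in> interval_chains m n" for l j
      unfolding key[OF c] mult.assoc prod.distrib[symmetric]
      by (intro arg_cong[where f = "\<lambda>x. pochhammer \<beta> n * x"] prod.cong refl) (simp add: mult_ac)
    then have "(\<Sum>(l, j)\<in>interval_chains m n.
        (\<Prod>i\<in>{..<n} - (\<Union>s\<in>{1..m}. {l s..j s}). \<beta> + of_nat i) *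
        (\<Prod>s=1..m.
          (fact (j s) * pochhammer (\<alpha> + of_nat (l s)) (j s - l s) * pochhammer \<gamma> (l s))
          / (fact (l s) * pochhammer \<gamma> (j s + 1)) * of_real k ^ (2 * (j s - l s))))
      = pochhammer \<beta> n * (\<Sum>(l, j)\<in>interval_chains m n. \<Prod>s=1..m.
        (fact (j s) * pochhammer (\<alpha> + of_nat (l s)) (j s - l s)
           * pochhammer \<beta> (l s) * pochhammer \<gamma> (l s))
        / (fact (l s) * pochhammer \<beta> (j s + 1) * pochhammer \<gamma> (j s + 1))
        * of_real k ^ (2 * (j s - l s)))"
      unfolding sum_distrib_left by (intro sum.cong) auto
    then show ?thesis
      using False by (simp only: heun_f_def heun_f_cancelled_def if_False mult.left_commute)
  qed
qed

lemma heun_coeff_eq_cancelled: "heun_coeff \<alpha> \<beta> \<gamma> k m n = heun_f_cancelled \<alpha> \<beta> \<gamma> k m n"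
  by (simp add: heun_coeff_def heun_f_cancelled_eq)

end

theory Submission
  imports Defs "HOL-Real_Asymp.Real_Asymp" "HOL-Complex_Analysis.Complex_Analysis"
begin

text \<open>
  Let \<open>c n\<close> be the coefficients of a power series \<open>F\<close>, and put \<open>\<kappa> = k\<^sup>2\<close>. Because
  \<open>\<delta> = \<beta> + 1\<close>, Heun's equation factors into two first-order equations,
  \<open>U = (1 - z) F' - \<beta> F\<close> and \<open>z (1 - \<kappa> z) U' + (\<gamma> - \<kappa> \<alpha> z) U + w F = 0\<close>. On coefficients these
  are two-term recurrences for \<open>c\<close> and for its defect \<open>(n + 1) c (n + 1) - (\<beta> + n) c n\<close>.
  Splitting the interval chains according to whether the last interval ends at \<open>n\<close> shows that
  the chain sums satisfy the solved form of these recurrences. As \<open>\<kappa> < 1\<close>, the pair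
  (coefficient, defect) eventually grows at most by a factor \<open>\<rho>\<close> per step, for every \<open>\<rho> > 1\<close>,
  so the series converges in the unit disk. Uniqueness holds since the recurrences determine
  \<open>c\<close> from \<open>c 0\<close> when \<open>\<gamma>\<close> is not a non-positive integer.
\<close>

section \<open>Interval chains and the recurrence of the chain sums\<close>

definition chain_weight :: "complex \<Rightarrow> complex \<Rightarrow> real \<Rightarrow> nat \<Rightarrow> nat \<Rightarrow> complex" where
  "chain_weight \<alpha> \<gamma> k l j =
     (fact j * pochhammer (\<alpha> + of_nat l) (j - l) * pochhammer \<gamma> l)
       / (fact l * pochhammer \<gamma> (j + 1)) * of_real k ^ (2 * (j - l))"

lemma finite_interval_chains: "finite (interval_chains m n)"
proof (rule finite_subset)
  show "interval_chains m n \<subseteq> ({1..m} \<rightarrow>\<^sub>E {..<n}) \<times> ({1..m} \<rightarrow>\<^sub>E {..<n})"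
    by (auto simp: interval_chains_def)
qed (intro finite_cartesian_product finite_PiE; simp)

lemma interval_chains_0: "interval_chains 0 n = {(\<lambda>_. undefined, \<lambda>_. undefined)}"
  by (auto simp: interval_chains_def)

lemma interval_chains_less_bound:
  assumes "(l, j) \<in> interval_chains m n" "s \<in> {1..m}"
  shows "l s \<le> j s" "j s < n"
  using assms by (auto simp: interval_chains_def PiE_def Pi_def)

text \<open>Pigeonhole: the right ends \<open>j s\<close> are \<open>m\<close> distinct numbers
  below \<open>n\<close>.\<close>

lemma interval_chains_empty:
  assumes "n < m"
  shows "interval_chains m n = {}"
proof (rule equals0I)
  fix p assume "p \<in> interval_chains m n"
  then obtain l j where c: "(l, j) \<in> interval_chains m n" by (cases p) auto
  have "inj_on j {1..m}"
  proof (rule linorder_inj_onI)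
    fix s t assume "s < t" "s \<in> {1..m}" "t \<in> {1..m}"
    then show "j s \<noteq> j t"
      using interval_chains_less[OF c, of s t] interval_chains_less_bound(1)[OF c, of t] by auto
  qed auto
  moreover have "j ` {1..m} \<subseteq> {..<n}"
    using interval_chains_less_bound(2)[OF c] by auto
  ultimately have "card {1..m} \<le> card {..<n}"
    by (rule card_inj_on_le) simp
  with assms show False by simp
qed

text \<open>A chain whose last interval ends at \<open>n\<close> is determined by the left end
  \<open>i\<close> of that interval and by the remaining intervals, which form a chain below
  \<open>i\<close>. In every other chain all intervals lie below \<open>n\<close>.\<close>

lemma interval_chains_Suc:
  "interval_chains (Suc m) (Suc n) = interval_chains (Suc m) n \<union>
     (\<lambda>(i, l, j). (l(Suc m := i), j(Suc m := n))) ` (SIGMA i:{..n}. interval_chains m i)"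
  (is "?L = ?A \<union> ?e ` ?S")
proof (intro equalityI subsetI)
  fix p assume "p \<in> ?L"
  then obtain l j where p: "p = (l, j)" and c: "(l, j) \<in> interval_chains (Suc m) (Suc n)"
    by (cases p) auto
  note b = interval_chains_less_bound[OF c]
  note ls = interval_chains_less[OF c]
  have ext: "l \<in> extensional {1..Suc m}" "j \<in> extensional {1..Suc m}"
    using c by (auto simp: interval_chains_def PiE_iff)
  show "p \<in> ?A \<union> ?e ` ?S"
  proof (cases "j (Suc m) = n")
    case False
    have "j s < n" if "s \<in> {1..Suc m}" for s
    proof (cases "s = Suc m")
      case True
      then show ?thesis using b(2)[of s] that False by auto
    next
      case s: False
      then show ?thesis using ls[of s "Suc m"] b[of "Suc m"] that by auto
    qed
    moreover from this have "l s < n" if "s \<in> {1..Suc m}" for s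
      using that b(1)[of s] by (meson le_less_trans)
    ultimately have "p \<in> ?A"
      using c ext unfolding p interval_chains_def by (auto simp: PiE_iff)
    then show ?thesis ..
  next
    case True
    \<comment> \<open>Resetting the last entries to \<open>undefined\<close> makes the shortened
      pair extensional on \<open>{1..m}\<close>. Its bound is \<open>l (Suc m)\<close>, since all
      earlier intervals end before that point.\<close>
    define l' where "l' = l(Suc m := undefined)"
    define j' where "j' = j(Suc m := undefined)"
    have j': "j s < l (Suc m)" if "s \<in> {1..m}" for s
      using ls[of s "Suc m"] that by auto
    then have "l s < l (Suc m)" if "s \<in> {1..m}" for s
      using b(1)[of s] that by (auto intro: le_less_trans)
    then have "(l', j') \<in> interval_chains m (l (Suc m))"
      using c ext j' b(1) unfolding interval_chains_def l'_def j'_def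
      by (auto simp: PiE_iff extensional_def)
    moreover have "l (Suc m) \<le> n"
      using b(1)[of "Suc m"] True by auto
    moreover have "p = ?e (l (Suc m), l', j')"
      using True by (auto simp: p l'_def j'_def)
    ultimately show ?thesis by blast
  qed
next
  fix p assume "p \<in> ?A \<union> ?e ` ?S"
  then show "p \<in> ?L"
  proof
    assume "p \<in> ?A"
    then show ?thesis
      by (auto simp: interval_chains_def PiE_iff intro: less_SucI)
  next
    assume "p \<in> ?e ` ?S"
    then obtain i l j where i: "i \<le> n" and c: "(l, j) \<in> interval_chains m i"
      and p: "p = (l(Suc m := i), j(Suc m := n))" by auto
    have lt: "l s < i" "j s < i" if "s \<in> {1..m}" for s
      using interval_chains_less_bound[OF c that] by auto
    have l: "(l(Suc m := i)) s < Suc n" and j: "(j(Suc m := n)) s < Suc n"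
      and lj: "(l(Suc m := i)) s \<le> (j(Suc m := n)) s" if "s \<in> {1..Suc m}" for s
      using that i lt[of s] interval_chains_less_bound(1)[OF c, of s] by (cases "s = Suc m"; simp)+
    have jl: "(j(Suc m := n)) s < (l(Suc m := i)) (s + 1)" if "s \<in> {1..<Suc m}" for s
      using that lt(2)[of s] c by (cases "s = m") (auto simp: interval_chains_def)
    have "l(Suc m := i) \<in> extensional {1..Suc m}" "j(Suc m := n) \<in> extensional {1..Suc m}"
      using c by (auto simp: interval_chains_def PiE_iff extensional_def)
    then show ?thesis
      unfolding p interval_chains_def PiE_iff
      using l j lj jl by blast
  qed
qed

definition chain_gap_prod :: "complex \<Rightarrow> nat \<Rightarrow> nat \<Rightarrow> (nat \<Rightarrow> nat) \<Rightarrow> (nat \<Rightarrow> nat) \<Rightarrow> complex" where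
  "chain_gap_prod \<beta> m n l j = (\<Prod>i\<in>{..<n} - (\<Union>s\<in>{1..m}. {l s..j s}). \<beta> + of_nat i)"

text \<open>For \<open>m = 0\<close> there is exactly one chain, the empty one, and its gap product
  is the full Pochhammer symbol. The case distinction of the definition thus disappears.\<close>

lemma heun_f_cancelled_alt:
  "heun_f_cancelled \<alpha> \<beta> \<gamma> k m n =
     (-1) ^ m * (\<Sum>(l, j)\<in>interval_chains m n.
        chain_gap_prod \<beta> m n l j * (\<Prod>s=1..m. chain_weight \<alpha> \<gamma> k (l s) (j s)))"
proof (cases "m = 0")
  case True
  then show ?thesis
    by (simp add: heun_f_cancelled_def chain_gap_prod_def interval_chains_0 pochhammer_prod
        atLeast0LessThan)
next
  case False
  then show ?thesis by (simp add: heun_f_cancelled_def chain_gap_prod_def chain_weight_def)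
qed

lemma chain_gap_prod_Suc:
  assumes c: "(l, j) \<in> interval_chains m n"
  shows "chain_gap_prod \<beta> m (Suc n) l j = (\<beta> + of_nat n) * chain_gap_prod \<beta> m n l j"
proof -
  have "{..<Suc n} - (\<Union>s\<in>{1..m}. {l s..j s}) = insert n ({..<n} - (\<Union>s\<in>{1..m}. {l s..j s}))"
    using interval_chains_less_bound(2)[OF c] by fastforce
  then show ?thesis by (simp add: chain_gap_prod_def)
qed

text \<open>The added interval \<open>{i..n}\<close> covers everything from \<open>i\<close> on, so
  the gaps that remain are those of the shorter chain below \<open>i\<close>.\<close>

lemma chain_gap_prod_extend:
  assumes c: "(l, j) \<in> interval_chains m i" and "i \<le> n"
  shows "chain_gap_prod \<beta> (Suc m) (Suc n) (l(Suc m := i)) (j(Suc m := n)) = chain_gap_prod \<beta> m i l j"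
proof -
  have "(\<Union>s\<in>{1..Suc m}. {(l(Suc m := i)) s..(j(Suc m := n)) s})
      = {i..n} \<union> (\<Union>s\<in>{1..m}. {l s..j s})"
    by (auto simp: atLeastAtMostSuc_conv)
  then have "{..<Suc n} - (\<Union>s\<in>{1..Suc m}. {(l(Suc m := i)) s..(j(Suc m := n)) s})
      = {..<i} - (\<Union>s\<in>{1..m}. {l s..j s})"
    using \<open>i \<le> n\<close> by auto
  then show ?thesis by (simp only: chain_gap_prod_def)
qed

text \<open>If no interval ends at \<open>n\<close>, then \<open>n\<close> is a new gap and
  contributes \<beta> + n. Otherwise the last interval \<open>{i..n}\<close> splits off with its
  weight and one of the signs, and a chain below \<open>i\<close> remains.\<close>

lemma heun_f_cancelled_Suc:
  "heun_f_cancelled \<alpha> \<beta> \<gamma> k (Suc m) (Suc n) =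
     (\<beta> + of_nat n) * heun_f_cancelled \<alpha> \<beta> \<gamma> k (Suc m) n
     - (\<Sum>i\<le>n. chain_weight \<alpha> \<gamma> k i n * heun_f_cancelled \<alpha> \<beta> \<gamma> k m i)"
proof -
  let ?e = "\<lambda>(i, l, j). (l(Suc m := i), j(Suc m := n))"
  let ?S = "SIGMA i:{..n}. interval_chains m i"
  let ?W = "\<lambda>M l j. \<Prod>s=1..M. chain_weight \<alpha> \<gamma> k (l s) (j s)"
  let ?t = "\<lambda>M N (l, j). chain_gap_prod \<beta> M N l j * ?W M l j"
  define S where "S M N = (\<Sum>p\<in>interval_chains M N. ?t M N p)" for M N
  have inj: "inj_on ?e ?S"
  proof (rule inj_onI)
    fix x y assume x: "x \<in> ?S" and y: "y \<in> ?S" and eq: "?e x = ?e y"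
    obtain i l j where [simp]: "x = (i, l, j)" by (cases x)
    obtain i' l' j' where [simp]: "y = (i', l', j')" by (cases y)
    \<comment> \<open>Extensional functions on \<open>{1..m}\<close> have a known value at
      \<open>Suc m\<close>, so the overwritten entry can be restored.\<close>
    have *: "l (Suc m) = undefined" "l' (Suc m) = undefined"
      "j (Suc m) = undefined" "j' (Suc m) = undefined"
      using x y by (auto simp: interval_chains_def PiE_iff extensional_def)
    have "l(Suc m := i) = l'(Suc m := i')" "j(Suc m := n) = j'(Suc m := n)"
      using eq by auto
    then have "i = i'" "l = l'" "j = j'"
      using * by (metis fun_upd_same fun_upd_triv fun_upd_upd)+
    then show "x = y" by simp
  qed
  \<comment> \<open>The last right end is below \<open>n\<close> in the first set and equal to
    \<open>n\<close> in the second.\<close>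
  have disj: "interval_chains (Suc m) n \<inter> ?e ` ?S = {}"
    by (auto dest: interval_chains_less_bound(2)[of _ _ _ _ "Suc m"])
  have fin: "finite ?S" by (simp add: finite_interval_chains)
  have "(\<Sum>p\<in>interval_chains (Suc m) (Suc n). ?t (Suc m) (Suc n) p)
      = (\<Sum>p\<in>interval_chains (Suc m) n. ?t (Suc m) (Suc n) p)
      + (\<Sum>p\<in>?e ` ?S. ?t (Suc m) (Suc n) p)"
    unfolding interval_chains_Suc
    by (rule sum.union_disjoint) (use fin disj in \<open>auto simp: finite_interval_chains\<close>)
  also have "(\<Sum>p\<in>interval_chains (Suc m) n. ?t (Suc m) (Suc n) p)
      = (\<beta> + of_nat n) * (\<Sum>p\<in>interval_chains (Suc m) n. ?t (Suc m) n p)"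
    unfolding sum_distrib_left
    by (rule sum.cong) (auto simp: chain_gap_prod_Suc)
  also have "(\<Sum>p\<in>?e ` ?S. ?t (Suc m) (Suc n) p) = (\<Sum>p\<in>?S. ?t (Suc m) (Suc n) (?e p))"
    by (rule sum.reindex[OF inj, unfolded o_def])
  also have "\<dots> = (\<Sum>(i, p)\<in>?S. chain_weight \<alpha> \<gamma> k i n * ?t m i p)"
  proof (rule sum.cong[OF refl], clarify)
    fix i l j assume "i \<le> n" and c: "(l, j) \<in> interval_chains m i"
    have "?W (Suc m) (l(Suc m := i)) (j(Suc m := n)) = ?W m l j * chain_weight \<alpha> \<gamma> k i n"
      by (simp add: prod.nat_ivl_Suc')
    then show "chain_gap_prod \<beta> (Suc m) (Suc n) (l(Suc m := i)) (j(Suc m := n)) *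
        ?W (Suc m) (l(Suc m := i)) (j(Suc m := n))
        = chain_weight \<alpha> \<gamma> k i n * (chain_gap_prod \<beta> m i l j * ?W m l j)"
      by (simp only: chain_gap_prod_extend[OF c \<open>i \<le> n\<close>] mult_ac)
  qed
  also have "\<dots> = (\<Sum>i\<le>n. chain_weight \<alpha> \<gamma> k i n * (\<Sum>p\<in>interval_chains m i. ?t m i p))"
    by (subst sum.Sigma[symmetric]) (simp_all add: finite_interval_chains sum_distrib_left)
  finally have *: "S (Suc m) (Suc n) = (\<beta> + of_nat n) * S (Suc m) n
      + (\<Sum>i\<le>n. chain_weight \<alpha> \<gamma> k i n * S m i)"
    unfolding S_def .
  have "heun_f_cancelled \<alpha> \<beta> \<gamma> k M N = (-1) ^ M * S M N" for M N
    unfolding S_def by (rule heun_f_cancelled_alt)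
  moreover have "(\<Sum>i\<le>n. chain_weight \<alpha> \<gamma> k i n * ((-1) ^ m * S m i))
      = (-1) ^ m * (\<Sum>i\<le>n. chain_weight \<alpha> \<gamma> k i n * S m i)"
    by (simp add: sum_distrib_left mult_ac)
  ultimately show ?thesis by (simp add: * algebra_simps)
qed

lemma heun_f_cancelled_0: "heun_f_cancelled \<alpha> \<beta> \<gamma> k 0 n = pochhammer \<beta> n"
  by (simp add: heun_f_cancelled_def)

lemma heun_f_cancelled_eq_0:
  assumes "n < m"
  shows "heun_f_cancelled \<alpha> \<beta> \<gamma> k m n = 0"
  by (simp add: heun_f_cancelled_alt interval_chains_empty[OF assms])

section \<open>Coefficients of the series and their two coupled recurrences\<close>

definition heun_row :: "complex \<Rightarrow> complex \<Rightarrow> complex \<Rightarrow> real \<Rightarrow> complex \<Rightarrow> nat \<Rightarrow> complex" where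
  "heun_row \<alpha> \<beta> \<gamma> k w n = (\<Sum>m\<le>n. heun_f_cancelled \<alpha> \<beta> \<gamma> k m n * w ^ m)"

text \<open>The terms with \<open>n < m\<close> vanish, so all rows up to \<open>N\<close> can be
  summed over one common range of \<open>m\<close>, as interchanging the sums over \<open>m\<close>
  and \<open>i\<close> requires.\<close>

lemma heun_row_eq:
  assumes "n \<le> N"
  shows "heun_row \<alpha> \<beta> \<gamma> k w n = (\<Sum>m\<le>N. heun_f_cancelled \<alpha> \<beta> \<gamma> k m n * w ^ m)"
  unfolding heun_row_def
  by (rule sum.mono_neutral_left) (use assms in \<open>auto simp: heun_f_cancelled_eq_0\<close>)

lemma heun_row_0: "heun_row \<alpha> \<beta> \<gamma> k w 0 = 1"
  by (simp add: heun_row_def heun_f_cancelled_0)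

text \<open>This is the chain recurrence multiplied by powers of \<open>w\<close> and summed over
  \<open>m\<close>. The split-off interval supplies the factor \<open>- w\<close>, and the term for
  \<open>m = 0\<close> follows the Pochhammer recurrence.\<close>

lemma heun_row_Suc:
  "heun_row \<alpha> \<beta> \<gamma> k w (Suc n) = (\<beta> + of_nat n) * heun_row \<alpha> \<beta> \<gamma> k w n
     - w * (\<Sum>i\<le>n. chain_weight \<alpha> \<gamma> k i n * heun_row \<alpha> \<beta> \<gamma> k w i)"
proof -
  let ?f = "heun_f_cancelled \<alpha> \<beta> \<gamma> k"
  have "heun_row \<alpha> \<beta> \<gamma> k w (Suc n) = ?f 0 (Suc n) + (\<Sum>m\<le>n. ?f (Suc m) (Suc n) * w ^ Suc m)"
    by (simp only: heun_row_def sum.atMost_Suc_shift power_0 mult_1_right)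
  also have "(\<Sum>m\<le>n. ?f (Suc m) (Suc n) * w ^ Suc m)
      = (\<beta> + of_nat n) * (\<Sum>m\<le>n. ?f (Suc m) n * w ^ Suc m)
      - w * (\<Sum>m\<le>n. \<Sum>i\<le>n. chain_weight \<alpha> \<gamma> k i n * ?f m i * w ^ m)"
    unfolding heun_f_cancelled_Suc
    by (simp add: left_diff_distrib right_diff_distrib sum_subtractf sum_distrib_left sum_distrib_right mult_ac)
  also have "(\<Sum>m\<le>n. \<Sum>i\<le>n. chain_weight \<alpha> \<gamma> k i n * ?f m i * w ^ m)
      = (\<Sum>i\<le>n. chain_weight \<alpha> \<gamma> k i n * heun_row \<alpha> \<beta> \<gamma> k w i)"
    by (subst sum.swap) (simp add: heun_row_eq[of _ n] sum_distrib_left mult_ac)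
  also have "?f 0 (Suc n) = (\<beta> + of_nat n) * ?f 0 n"
    by (simp add: heun_f_cancelled_0 pochhammer_Suc mult_ac)
  \<comment> \<open>The range is taken up to \<open>Suc n\<close>, where the last term is zero.
    Splitting off \<open>m = 0\<close> then leaves exactly the shifted indices \<open>Suc m\<close>
    with \<open>m\<close> up to \<open>n\<close>.\<close>
  also have "?f 0 n = heun_row \<alpha> \<beta> \<gamma> k w n - (\<Sum>m\<le>n. ?f (Suc m) n * w ^ Suc m)"
    unfolding heun_row_eq[OF le_SucI[OF order.refl]] sum.atMost_Suc_shift by simp
  finally show ?thesis by (simp add: algebra_simps)
qed

text \<open>Raising the right end from \<open>n\<close> to \<open>Suc n\<close> multiplies the
  weight by a factor independent of \<open>i\<close>. The weighted sums over \<open>i\<close>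
  therefore obey a first-order recurrence in \<open>n\<close>.\<close>

lemma chain_weight_Suc:
  assumes "\<gamma> \<notin> \<int>\<^sub>\<le>\<^sub>0" "i \<le> n"
  shows "(\<gamma> + of_nat (Suc n)) * chain_weight \<alpha> \<gamma> k i (Suc n)
    = of_nat (Suc n) * (of_real k ^ 2 * (\<alpha> + of_nat n)) * chain_weight \<alpha> \<gamma> k i n"
proof -
  have nz: "\<gamma> + of_nat j \<noteq> 0" for j
    using assms(1) plus_of_nat_eq_0_imp by blast
  then have "pochhammer \<gamma> j \<noteq> 0" for j
    by (simp add: pochhammer_prod)
  moreover have "Suc n - i = Suc (n - i)" using assms(2) by simp
  moreover have "\<alpha> + of_nat i + of_nat (n - i) = \<alpha> + of_nat n"
    using assms(2) by (simp add: of_nat_diff)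
  moreover have "pochhammer \<gamma> (Suc n + 1) = pochhammer \<gamma> (n + 1) * (\<gamma> + of_nat (Suc n))"
    using pochhammer_Suc[of \<gamma> "Suc n"] by simp
  ultimately show ?thesis
    using nz[of "Suc n"]
    by (simp add: chain_weight_def pochhammer_Suc[of "\<alpha> + of_nat i"] divide_simps power2_eq_square
        del: of_nat_Suc)
qed

lemma chain_weight_diag:
  assumes "\<gamma> \<notin> \<int>\<^sub>\<le>\<^sub>0"
  shows "(\<gamma> + of_nat n) * chain_weight \<alpha> \<gamma> k n n = 1"
proof -
  have nz: "\<gamma> + of_nat j \<noteq> 0" for j
    using assms(1) plus_of_nat_eq_0_imp by blast
  then have "pochhammer \<gamma> j \<noteq> 0" for j
    by (simp add: pochhammer_prod)
  with nz show ?thesis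
    by (simp add: chain_weight_def pochhammer_Suc)
qed

definition heun_defect :: "complex \<Rightarrow> (nat \<Rightarrow> complex) \<Rightarrow> nat \<Rightarrow> complex" where
  "heun_defect \<beta> c n = of_nat (Suc n) * c (Suc n) - (\<beta> + of_nat n) * c n"

text \<open>These are the coefficients of the second first-order equation, with the defect as the
  coefficients of \<open>U\<close>. The constant term has its own clause because no defect of index
  -1 exists.\<close>

definition heun_recurrence ::
  "complex \<Rightarrow> complex \<Rightarrow> complex \<Rightarrow> complex \<Rightarrow> complex \<Rightarrow> (nat \<Rightarrow> complex) \<Rightarrow> bool" where
  "heun_recurrence \<kappa> w \<alpha> \<beta> \<gamma> c \<longleftrightarrow> \<gamma> * heun_defect \<beta> c 0 = - w * c 0 \<and>
     (\<forall>n. (\<gamma> + of_nat (Suc n)) * heun_defect \<beta> c (Suc n)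
        = \<kappa> * (\<alpha> + of_nat n) * heun_defect \<beta> c n - w * c (Suc n))"

lemma heun_row_recurrence:
  assumes \<gamma>: "\<gamma> \<notin> \<int>\<^sub>\<le>\<^sub>0"
  shows "heun_recurrence (of_real k ^ 2) w \<alpha> \<beta> \<gamma> (\<lambda>n. heun_row \<alpha> \<beta> \<gamma> k w n / fact n)"
proof -
  let ?g = "heun_row \<alpha> \<beta> \<gamma> k w"
  define S where "S n = (\<Sum>i\<le>n. chain_weight \<alpha> \<gamma> k i n * ?g i)" for n
  \<comment> \<open>By \<open>heun_row_Suc\<close> the defect is, up to the factor
    \<open>- w / fact n\<close>, the weighted sum \<open>S n\<close>. It remains to find the
    recurrence of \<open>S\<close>.\<close>
  have defect: "heun_defect \<beta> (\<lambda>n. ?g n / fact n) n = - w * S n / fact n" for n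
  proof -
    have "of_nat (Suc n) * (?g (Suc n) / fact (Suc n)) = ?g (Suc n) / fact n"
      unfolding fact_Suc by (simp del: of_nat_Suc)
    then show ?thesis
      unfolding heun_defect_def by (simp add: heun_row_Suc S_def diff_divide_distrib)
  qed
  have S0: "\<gamma> * S 0 = 1"
    using chain_weight_diag[OF \<gamma>, of 0] by (simp add: S_def heun_row_0)
  \<comment> \<open>The terms with \<open>i\<close> up to \<open>n\<close> reproduce
    \<open>S n\<close>. The diagonal term \<open>i = Suc n\<close> gives the inhomogeneity
    \<open>?g (Suc n)\<close>.\<close>
  have SS: "(\<gamma> + of_nat (Suc n)) * S (Suc n)
      = of_nat (Suc n) * (of_real k ^ 2 * (\<alpha> + of_nat n)) * S n + ?g (Suc n)" for n
  proof -
    have "(\<gamma> + of_nat (Suc n)) * S (Suc n)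
        = (\<Sum>i\<le>n. (\<gamma> + of_nat (Suc n)) * chain_weight \<alpha> \<gamma> k i (Suc n) * ?g i)
        + (\<gamma> + of_nat (Suc n)) * chain_weight \<alpha> \<gamma> k (Suc n) (Suc n) * ?g (Suc n)"
      by (simp add: S_def sum_distrib_left distrib_left mult.assoc)
    also have "(\<Sum>i\<le>n. (\<gamma> + of_nat (Suc n)) * chain_weight \<alpha> \<gamma> k i (Suc n) * ?g i)
        = of_nat (Suc n) * (of_real k ^ 2 * (\<alpha> + of_nat n)) * S n"
      unfolding S_def sum_distrib_left
      by (rule sum.cong) (simp_all only: chain_weight_Suc[OF \<gamma>] atMost_iff mult.assoc)
    finally show ?thesis by (simp only: chain_weight_diag[OF \<gamma>] mult_1_left)
  qed
  show ?thesis
    unfolding heun_recurrence_def defect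
  proof (intro conjI allI)
    show "\<gamma> * (- w * S 0 / fact 0) = - w * (?g 0 / fact 0)"
      using S0 by (simp add: heun_row_0 algebra_simps)
    fix n
    have "(\<gamma> + of_nat (Suc n)) * (- w * S (Suc n) / fact (Suc n))
        = - w * ((\<gamma> + of_nat (Suc n)) * S (Suc n)) / fact (Suc n)"
      by simp
    also have "\<dots> = of_real k ^ 2 * (\<alpha> + of_nat n) * (- w * (of_nat (Suc n) * S n / fact (Suc n)))
        - w * (?g (Suc n) / fact (Suc n))"
      unfolding SS by (simp add: algebra_simps add_divide_distrib diff_divide_distrib del: fact_Suc of_nat_Suc)
    also have "of_nat (Suc n) * S n / fact (Suc n) = S n / fact n"
      unfolding fact_Suc by (simp del: of_nat_Suc)
    finally show "(\<gamma> + of_nat (Suc n)) * (- w * S (Suc n) / fact (Suc n))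
        = of_real k ^ 2 * (\<alpha> + of_nat n) * (- w * S n / fact n) - w * (?g (Suc n) / fact (Suc n))"
      by simp
  qed
qed

text \<open>Induction on the pair of coefficient and defect: together they give the next
  coefficient, and the recurrence then gives the next defect after division by \<gamma> + n +
  1.\<close>

lemma heun_recurrence_unique:
  assumes \<gamma>: "\<gamma> \<notin> \<int>\<^sub>\<le>\<^sub>0"
    and c: "heun_recurrence \<kappa> w \<alpha> \<beta> \<gamma> c" and d: "heun_recurrence \<kappa> w \<alpha> \<beta> \<gamma> d"
    and "c 0 = d 0"
  shows "c = d"
proof -
  have nz: "\<gamma> + of_nat j \<noteq> 0" for j
    using \<gamma> plus_of_nat_eq_0_imp by blast
  have step: "c (Suc n) = d (Suc n)" if "c n = d n" "heun_defect \<beta> c n = heun_defect \<beta> d n" for n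
    using that unfolding heun_defect_def by (simp del: of_nat_Suc)
  have "c n = d n \<and> heun_defect \<beta> c n = heun_defect \<beta> d n" for n
  proof (induction n)
    case 0
    have "\<gamma> * heun_defect \<beta> c 0 = \<gamma> * heun_defect \<beta> d 0"
      using c d \<open>c 0 = d 0\<close> unfolding heun_recurrence_def by simp
    then show ?case using nz[of 0] \<open>c 0 = d 0\<close> by simp
  next
    case (Suc n)
    then have "c (Suc n) = d (Suc n)" using step by blast
    moreover from this have "(\<gamma> + of_nat (Suc n)) * heun_defect \<beta> c (Suc n)
        = (\<gamma> + of_nat (Suc n)) * heun_defect \<beta> d (Suc n)"
      using c d Suc unfolding heun_recurrence_def by metis
    ultimately show ?case using nz[of "Suc n"] by (metis mult_cancel_left)
  qed
  then show ?thesis by blast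
qed

section \<open>Convergence in the unit disk\<close>

text \<open>Solved for the next defect, the recurrence has factors tending in norm to that of
  \<kappa> at the old defect and to 0 at the coefficient. Solved for the next coefficient, it has
  factors tending to 1 and 0. Hence the maximum of both norms eventually grows by at most \<rho> per
  step.\<close>

lemma heun_recurrence_conv_radius:
  assumes rec: "heun_recurrence \<kappa> w \<alpha> \<beta> \<gamma> c" and \<kappa>: "norm \<kappa> < 1"
  shows "conv_radius c \<ge> 1"
proof (rule conv_radius_geI_ex)
  fix r :: real assume r: "0 < r" "ereal r < 1"
  \<comment> \<open>Any number strictly between 1 and 1 / r serves; \<open>2 / (1 + r)\<close> is
    one.\<close>
  then obtain \<rho> where \<rho>: "1 < \<rho>" "\<rho> * r < 1"
    by (intro that[of "2 / (1 + r)"]) (auto simp: field_simps)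
  \<comment> \<open>The index shift pairs exactly the two values that determine the next defect,
    \<open>heun_defect \<beta> c (Suc n)\<close>.\<close>
  define M where "M n = max (norm (c (Suc n))) (norm (heun_defect \<beta> c n))" for n
  \<comment> \<open>The three estimates bound the next defect by \<open>M n\<close>, bound the next
    coefficient by \<open>\<rho> * M n\<close>, and allow division by the lower bound for the norm
    of \<gamma> + n + 1.\<close>
  have "eventually (\<lambda>n. (norm \<kappa> * (norm \<alpha> + real n) + norm w) \<le> real (Suc n) - norm \<gamma>) at_top"
    using \<kappa> by real_asymp
  moreover have "eventually (\<lambda>n. norm \<beta> + real (Suc n) + 1 \<le> \<rho> * real (Suc (Suc n))) at_top"
    using \<rho> by real_asymp
  moreover have "eventually (\<lambda>n. real (Suc n) - norm \<gamma> > 0) at_top"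
    by real_asymp
  ultimately have "eventually (\<lambda>n. M (Suc n) \<le> \<rho> * M n) at_top"
  proof eventually_elim
    case (elim n)
    have M0: "0 \<le> M n" by (simp add: M_def le_max_iff_disj)
    have cM: "norm (c (Suc n)) \<le> M n" and dM: "norm (heun_defect \<beta> c n) \<le> M n"
      by (simp_all add: M_def)
    have "(real (Suc n) - norm \<gamma>) * norm (heun_defect \<beta> c (Suc n))
        \<le> norm (\<gamma> + of_nat (Suc n)) * norm (heun_defect \<beta> c (Suc n))"
      using norm_diff_ineq[of "of_nat (Suc n)" \<gamma>]
      by (intro mult_right_mono) (simp_all add: add.commute del: of_nat_Suc)
    also have "\<dots> = norm (\<kappa> * (\<alpha> + of_nat n) * heun_defect \<beta> c n - w * c (Suc n))"
      using rec unfolding heun_recurrence_def by (simp add: norm_mult[symmetric])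
    also have "\<dots> \<le> norm \<kappa> * (norm \<alpha> + real n) * norm (heun_defect \<beta> c n) + norm w * norm (c (Suc n))"
      by (intro order.trans[OF norm_triangle_ineq4] add_mono)
        (auto simp: norm_mult intro!: mult_mono norm_triangle_le)
    also have "\<dots> \<le> norm \<kappa> * (norm \<alpha> + real n) * M n + norm w * M n"
      using cM dM by (intro add_mono mult_left_mono) auto
    also have "\<dots> = (norm \<kappa> * (norm \<alpha> + real n) + norm w) * M n"
      by (simp add: distrib_right)
    also have "\<dots> \<le> (real (Suc n) - norm \<gamma>) * M n"
      by (intro mult_right_mono elim M0)
    finally have d: "norm (heun_defect \<beta> c (Suc n)) \<le> M n"
      using elim by simp
    have "real (Suc (Suc n)) * norm (c (Suc (Suc n)))
        = norm ((\<beta> + of_nat (Suc n)) * c (Suc n) + heun_defect \<beta> c (Suc n))"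
      by (simp add: heun_defect_def norm_mult del: of_nat_Suc)
    also have "\<dots> \<le> (norm \<beta> + real (Suc n)) * norm (c (Suc n)) + norm (heun_defect \<beta> c (Suc n))"
      by (intro order.trans[OF norm_triangle_ineq] add_mono)
        (auto simp: norm_mult simp del: of_nat_Suc intro!: mult_right_mono norm_triangle_le)
    also have "\<dots> \<le> (norm \<beta> + real (Suc n)) * M n + M n"
      using cM d by (intro add_mono mult_left_mono) auto
    also have "\<dots> = (norm \<beta> + real (Suc n) + 1) * M n"
      by (simp add: algebra_simps)
    also have "\<dots> \<le> (\<rho> * real (Suc (Suc n))) * M n"
      by (intro mult_right_mono elim M0)
    finally have "norm (c (Suc (Suc n))) \<le> \<rho> * M n"
      by simp
    moreover have "M n \<le> \<rho> * M n"
      using \<rho> M0 by (simp add: mult_le_cancel_right1)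
    ultimately show ?case using d by (simp add: M_def[of "Suc n"])
  qed
  then obtain N where N: "M (Suc n) \<le> \<rho> * M n" if "n \<ge> N" for n
    by (auto simp: eventually_sequentially)
  have bound: "M (N + n) \<le> M N * \<rho> ^ n" for n
  proof (induction n)
    case (Suc n)
    have "M (N + Suc n) \<le> \<rho> * M (N + n)" using N[of "N + n"] by simp
    also have "\<dots> \<le> \<rho> * (M N * \<rho> ^ n)" using Suc \<rho> by (intro mult_left_mono) auto
    finally show ?case by (simp add: mult_ac)
  qed simp
  \<comment> \<open>The shift is \<open>Suc N\<close> because \<open>M (N + n)\<close> controls the
    coefficient with index \<open>Suc (N + n)\<close>.\<close>
  have "summable (\<lambda>n. c (n + Suc N) * of_real r ^ (n + Suc N))"
  proof (rule summable_comparison_test)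
    show "summable (\<lambda>n. M N * r ^ Suc N * (\<rho> * r) ^ n)"
      using \<rho> r by (intro summable_mult summable_geometric) (simp add: abs_mult)
    have "norm (c (n + Suc N) * of_real r ^ (n + Suc N)) \<le> M N * r ^ Suc N * (\<rho> * r) ^ n" for n
    proof -
      have "norm (c (n + Suc N)) \<le> M N * \<rho> ^ n"
        using bound[of n] by (simp add: M_def add.commute)
      then have "norm (c (n + Suc N)) * r ^ (n + Suc N) \<le> M N * \<rho> ^ n * r ^ (n + Suc N)"
        using r by (intro mult_right_mono) auto
      then show ?thesis
        using r by (simp add: norm_mult norm_power power_add power_mult_distrib mult_ac)
    qed
    then show "\<exists>N'. \<forall>n\<ge>N'. norm (c (n + Suc N) * of_real r ^ (n + Suc N))
        \<le> M N * r ^ Suc N * (\<rho> * r) ^ n" by blast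
  qed
  then have "summable (\<lambda>n. c n * of_real r ^ n)"
    by (simp only: summable_iff_shift[of "\<lambda>n. c n * of_real r ^ n"])
  then show "\<exists>z. norm z = r \<and> summable (\<lambda>n. c n * z ^ n)"
    using r by (intro exI[of _ "of_real r"]) simp
qed

section \<open>Heun's equation in factored form and as a recurrence\<close>

text \<open>Heun's equation in the factored form, cleared of denominators.\<close>

definition heun_residual ::
  "complex \<Rightarrow> complex \<Rightarrow> complex \<Rightarrow> complex \<Rightarrow> complex \<Rightarrow> (complex \<Rightarrow> complex) \<Rightarrow> complex \<Rightarrow> complex" where
  "heun_residual \<kappa> w \<alpha> \<beta> \<gamma> F = (let U = (\<lambda>z. (1 - z) * deriv F z - \<beta> * F z) in
     (\<lambda>z. z * (deriv U z - \<kappa> * (z * deriv U z + \<alpha> * U z)) + \<gamma> * U z + w * F z))"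

lemma holomorphic_heun_residual:
  assumes "F holomorphic_on A" "open A"
  shows "heun_residual \<kappa> w \<alpha> \<beta> \<gamma> F holomorphic_on A"
  unfolding heun_residual_def Let_def
  using assms by (intro holomorphic_intros) auto

text \<open>Differentiating \<open>U\<close> produces the coefficient \<beta> + 1 of the first
  derivative, which is why \<delta> = \<beta> + 1 makes the equation factor. With this \<delta> the
  Heun parameter \<epsilon> equals \<alpha> - \<gamma>.\<close>

lemma heun_residual_eq:
  assumes F: "F holomorphic_on ball 0 1" and z: "z \<in> ball 0 1 - {0}"
    and \<kappa>: "\<kappa> \<noteq> 0" "norm \<kappa> < 1" and \<epsilon>: "\<epsilon> = \<alpha> - \<gamma>"
  shows "heun_residual \<kappa> w \<alpha> \<beta> \<gamma> F z = z * (z - 1) * (\<kappa> * z - 1) *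
    (deriv (deriv F) z + (\<gamma> / z + (\<beta> + 1) / (z - 1) + \<epsilon> / (z - 1 / \<kappa>)) * deriv F z
       + (\<alpha> * \<beta> * z - (- ((w - \<beta> * \<gamma>) / \<kappa>))) / (z * (z - 1) * (z - 1 / \<kappa>)) * F z)"
proof -
  have "deriv F holomorphic_on ball 0 1"
    using F by (intro holomorphic_deriv) auto
  then have "(F has_field_derivative deriv F z) (at z)"
    "(deriv F has_field_derivative deriv (deriv F) z) (at z)"
    using F z by (auto intro: holomorphic_derivI[of _ "ball 0 1"])
  then have dU: "deriv (\<lambda>z. (1 - z) * deriv F z - \<beta> * F z) z
      = (1 - z) * deriv (deriv F) z - (\<beta> + 1) * deriv F z"
    by (intro DERIV_imp_deriv) (auto intro!: derivative_eq_intros simp: algebra_simps)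
  \<comment> \<open>The singular point 1 / \<kappa> lies outside the unit disk.\<close>
  have "norm (\<kappa> * z) < 1"
    using mult_strict_mono'[OF \<kappa>(2), of "norm z" 1] z by (simp add: norm_mult)
  then have nz: "z \<noteq> 0" "z - 1 \<noteq> 0" "\<kappa> * z - 1 \<noteq> 0"
    using z by auto
  have *: "z - 1 / \<kappa> = (\<kappa> * z - 1) / \<kappa>"
    using \<kappa> by (simp add: field_simps)
  \<comment> \<open>With the derivatives and fractions abbreviated, \<open>P\<close> cancels one
    denominator at a time, and a polynomial identity remains.\<close>
  define d1 d2 where "d1 = deriv F z" and "d2 = deriv (deriv F) z"
  define P where "P = z * (z - 1) * (\<kappa> * z - 1)"
  define E Q where "E = \<epsilon> / (z - 1 / \<kappa>)"
    and "Q = (\<alpha> * \<beta> * z - (- ((w - \<beta> * \<gamma>) / \<kappa>))) / (z * (z - 1) * (z - 1 / \<kappa>))"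
  have "P * (d2 + (\<gamma> / z + (\<beta> + 1) / (z - 1) + E) * d1 + Q * F z)
     = P * d2 + (\<gamma> * (P / z) + (\<beta> + 1) * (P / (z - 1)) + P * E) * d1 + P * Q * F z"
    by (simp add: algebra_simps)
  moreover have "P / z = (z - 1) * (\<kappa> * z - 1)" "P / (z - 1) = z * (\<kappa> * z - 1)"
    using nz by (simp_all add: P_def)
  moreover have "P * E = \<kappa> * (\<alpha> - \<gamma>) * z * (z - 1)"
    using nz \<kappa> by (simp add: P_def E_def * \<epsilon>)
  moreover have "P * Q = \<kappa> * (\<alpha> * \<beta> * z) + w - \<beta> * \<gamma>"
  proof -
    have "P * Q = \<kappa> * (\<alpha> * \<beta> * z - (- ((w - \<beta> * \<gamma>) / \<kappa>)))"
      using nz by (simp add: P_def Q_def *)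
    then show ?thesis using \<kappa> by (simp add: distrib_left add_diff_eq)
  qed
  ultimately have "P * (d2 + (\<gamma> / z + (\<beta> + 1) / (z - 1) + E) * d1 + Q * F z)
     = P * d2 + (\<gamma> * ((z - 1) * (\<kappa> * z - 1)) + (\<beta> + 1) * (z * (\<kappa> * z - 1))
         + \<kappa> * (\<alpha> - \<gamma>) * z * (z - 1)) * d1
       + (\<kappa> * (\<alpha> * \<beta> * z) + w - \<beta> * \<gamma>) * F z"
    by (simp only:)
  then show ?thesis
    unfolding heun_residual_def Let_def dU E_def[symmetric] Q_def[symmetric]
      d1_def[symmetric] d2_def[symmetric] P_def[symmetric]
    by (simp add: P_def algebra_simps)
qed

text \<open>The shape of \<open>heun_residual\<close> is repeated operation by operation, so that
  the expansion of the residual follows from the introduction rules alone.\<close>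

definition heun_residual_fps ::
  "complex \<Rightarrow> complex \<Rightarrow> complex \<Rightarrow> complex \<Rightarrow> complex \<Rightarrow> complex fps \<Rightarrow> complex fps" where
  "heun_residual_fps \<kappa> w \<alpha> \<beta> \<gamma> f = (let u = (1 - fps_X) * fps_deriv f - fps_const \<beta> * f in
     fps_X * (fps_deriv u - fps_const \<kappa> * (fps_X * fps_deriv u + fps_const \<alpha> * u))
       + fps_const \<gamma> * u + fps_const w * f)"

lemma has_fps_expansion_heun_residual:
  assumes "F has_fps_expansion f"
  shows "heun_residual \<kappa> w \<alpha> \<beta> \<gamma> F has_fps_expansion heun_residual_fps \<kappa> w \<alpha> \<beta> \<gamma> f"
  unfolding heun_residual_def heun_residual_fps_def Let_def
  by (intro fps_expansion_intros assms)

lemma heun_residual_fps_eq_0_iff: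
  "heun_residual_fps \<kappa> w \<alpha> \<beta> \<gamma> f = 0 \<longleftrightarrow> heun_recurrence \<kappa> w \<alpha> \<beta> \<gamma> (fps_nth f)"
proof -
  define u where "u = (1 - fps_X) * fps_deriv f - fps_const \<beta> * f"
  have u: "fps_nth u n = heun_defect \<beta> (fps_nth f) n" for n
    by (cases n) (simp_all add: u_def heun_defect_def left_diff_distrib algebra_simps)
  have R: "heun_residual_fps \<kappa> w \<alpha> \<beta> \<gamma> f =
      fps_X * (fps_deriv u - fps_const \<kappa> * (fps_X * fps_deriv u + fps_const \<alpha> * u))
        + fps_const \<gamma> * u + fps_const w * f"
    by (simp only: heun_residual_fps_def Let_def u_def)
  have X: "fps_nth (fps_X * fps_deriv u) n = of_nat n * fps_nth u n" for n
    by (cases n) simp_all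
  have "fps_nth (heun_residual_fps \<kappa> w \<alpha> \<beta> \<gamma> f) 0 = \<gamma> * fps_nth u 0 + w * fps_nth f 0"
    by (simp add: R)
  moreover have "fps_nth (heun_residual_fps \<kappa> w \<alpha> \<beta> \<gamma> f) (Suc n)
      = (\<gamma> + of_nat (Suc n)) * fps_nth u (Suc n)
        - \<kappa> * (\<alpha> + of_nat n) * fps_nth u n + w * fps_nth f (Suc n)" for n
    unfolding R by (simp add: X algebra_simps)
  moreover have "heun_residual_fps \<kappa> w \<alpha> \<beta> \<gamma> f = 0 \<longleftrightarrow>
      fps_nth (heun_residual_fps \<kappa> w \<alpha> \<beta> \<gamma> f) 0 = 0 \<and>
      (\<forall>n. fps_nth (heun_residual_fps \<kappa> w \<alpha> \<beta> \<gamma> f) (Suc n) = 0)"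
    unfolding fps_eq_iff fps_zero_nth by (metis not0_implies_Suc)
  moreover have "\<gamma> * fps_nth u 0 + w * fps_nth f 0 = 0 \<longleftrightarrow> \<gamma> * fps_nth u 0 = - w * fps_nth f 0"
    "x - y + z = 0 \<longleftrightarrow> x = y - z" for x y z :: complex
    by (auto simp: eq_neg_iff_add_eq_0 algebra_simps)
  ultimately show ?thesis
    unfolding heun_recurrence_def u[symmetric] by (simp only:)
qed

text \<open>This moves the problem to coefficients: the residual vanishes on the punctured disk
  exactly if its formal expansion at 0 is zero, which is the recurrence.\<close>

lemma is_local_heun_iff:
  assumes \<kappa>: "\<kappa> \<noteq> 0" "norm \<kappa> < 1"
  shows "is_local_heun (1 / \<kappa>) (- ((w - \<beta> * \<gamma>) / \<kappa>)) \<alpha> \<beta> \<gamma> (\<beta> + 1) F \<longleftrightarrow>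
    (\<exists>f. F has_fps_expansion f \<and> F holomorphic_on ball 0 1 \<and> fps_nth f 0 = 1 \<and>
       heun_recurrence \<kappa> w \<alpha> \<beta> \<gamma> (fps_nth f))"
proof -
  let ?R = "heun_residual \<kappa> w \<alpha> \<beta> \<gamma> F"
  have F0: "F 0 = fps_nth f 0" if "F has_fps_expansion f" for f
    using has_fps_expansion_imp_0_eq_fps_nth_0[OF that] .
  have iff: "is_local_heun (1 / \<kappa>) (- ((w - \<beta> * \<gamma>) / \<kappa>)) \<alpha> \<beta> \<gamma> (\<beta> + 1) F \<longleftrightarrow>
    F holomorphic_on ball 0 1 \<and> F 0 = 1 \<and> (\<forall>z\<in>ball 0 1 - {0}. ?R z = 0)"
  proof (cases "F holomorphic_on ball 0 1")
    case True
    have "\<kappa> * z \<noteq> 1" if "z \<in> ball 0 1" for z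
      using mult_strict_mono'[OF \<kappa>(2), of "norm z" 1] that
      by (metis dist_0_norm less_irrefl mem_ball mult_1 norm_ge_zero norm_mult norm_one)
    then have "z * (z - 1) * (\<kappa> * z - 1) \<noteq> 0" if "z \<in> ball 0 1 - {0}" for z
      using that by auto
    then show ?thesis
      using True by (simp add: is_local_heun_def Let_def analytic_on_open heun_residual_eq \<kappa>)
  qed (simp add: is_local_heun_def analytic_on_open)
  show ?thesis
  proof
    assume "is_local_heun (1 / \<kappa>) (- ((w - \<beta> * \<gamma>) / \<kappa>)) \<alpha> \<beta> \<gamma> (\<beta> + 1) F"
    then have hol: "F holomorphic_on ball 0 1" and "F 0 = 1"
      and R: "\<forall>z\<in>ball 0 1 - {0}. ?R z = 0"
      unfolding iff by blast+
    have "F analytic_on {0}"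
      using hol by (rule holomorphic_on_imp_analytic_at) auto
    then have f: "F has_fps_expansion fps_expansion F 0"
      by (rule analytic_at_imp_has_fps_expansion_0)
    \<comment> \<open>Multiplying by \<open>z\<close> removes the missing information at \<open>z = 0\<close>.\<close>
    have "(\<lambda>z. z * ?R z) has_fps_expansion
        fps_X * heun_residual_fps \<kappa> w \<alpha> \<beta> \<gamma> (fps_expansion F 0)"
      by (intro fps_expansion_intros has_fps_expansion_heun_residual f)
    moreover have "eventually (\<lambda>z. z * ?R z = 0) (nhds 0)"
      by (rule eventually_nhds_in_open[of "ball 0 1", THEN eventually_mono]) (use R in auto)
    then have "(\<lambda>z. z * ?R z) has_fps_expansion 0"
      by (simp add: has_fps_expansion_0_iff)
    ultimately have "fps_X * heun_residual_fps \<kappa> w \<alpha> \<beta> \<gamma> (fps_expansion F 0) = 0"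
      by (rule fps_expansion_unique_complex)
    then show "\<exists>f. F has_fps_expansion f \<and> F holomorphic_on ball 0 1 \<and> fps_nth f 0 = 1 \<and>
       heun_recurrence \<kappa> w \<alpha> \<beta> \<gamma> (fps_nth f)"
      using f hol \<open>F 0 = 1\<close> F0 by (auto simp: heun_residual_fps_eq_0_iff)
  next
    assume "\<exists>f. F has_fps_expansion f \<and> F holomorphic_on ball 0 1 \<and> fps_nth f 0 = 1 \<and>
       heun_recurrence \<kappa> w \<alpha> \<beta> \<gamma> (fps_nth f)"
    then obtain f where f: "F has_fps_expansion f" "F holomorphic_on ball 0 1" "fps_nth f 0 = 1"
      and "heun_residual_fps \<kappa> w \<alpha> \<beta> \<gamma> f = 0"
      by (auto simp: heun_residual_fps_eq_0_iff)
    then have "?R has_fps_expansion 0"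
      using has_fps_expansion_heun_residual[OF f(1)] by metis
    \<comment> \<open>A zero expansion gives vanishing near 0 only; the identity theorem extends it
      to the whole disk.\<close>
    then have "?R z = 0" if "z \<in> ball 0 1" for z
      by (rule has_fps_expansion_0_analytic_continuation[of _ "ball 0 1"])
        (use f that in \<open>auto intro: holomorphic_heun_residual\<close>)
    then show "is_local_heun (1 / \<kappa>) (- ((w - \<beta> * \<gamma>) / \<kappa>)) \<alpha> \<beta> \<gamma> (\<beta> + 1) F"
      unfolding iff using f F0 by auto
  qed
qed

section \<open>Uniqueness of the local solution and conclusion\<close>

text \<open>Both expansions at 0 satisfy the recurrence with initial value 1 and hence coincide. A
  function holomorphic in the disk equals the sum of its expansion there.\<close>

lemma is_local_heun_unique:
  assumes \<kappa>: "\<kappa> \<noteq> 0" "norm \<kappa> < 1" and \<gamma>: "\<gamma> \<notin> \<int>\<^sub>\<le>\<^sub>0"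
    and F: "is_local_heun (1 / \<kappa>) (- ((w - \<beta> * \<gamma>) / \<kappa>)) \<alpha> \<beta> \<gamma> (\<beta> + 1) F"
    and G: "is_local_heun (1 / \<kappa>) (- ((w - \<beta> * \<gamma>) / \<kappa>)) \<alpha> \<beta> \<gamma> (\<beta> + 1) G"
    and z: "z \<in> ball 0 1"
  shows "F z = G z"
proof -
  obtain f where f: "F has_fps_expansion f" "F holomorphic_on ball 0 1" "fps_nth f 0 = 1"
    "heun_recurrence \<kappa> w \<alpha> \<beta> \<gamma> (fps_nth f)"
    using F unfolding is_local_heun_iff[OF \<kappa>] by blast
  obtain g where g: "G has_fps_expansion g" "G holomorphic_on ball 0 1" "fps_nth g 0 = 1"
    "heun_recurrence \<kappa> w \<alpha> \<beta> \<gamma> (fps_nth g)"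
    using G unfolding is_local_heun_iff[OF \<kappa>] by blast
  have "fps_nth f = fps_nth g"
    using heun_recurrence_unique[OF \<gamma> f(4) g(4)] f g by simp
  then have "f = g" by (simp add: fps_nth_inject)
  then show ?thesis
    using has_fps_expansion_imp_eval_fps_eq[OF f(1) _ f(2), of z]
      has_fps_expansion_imp_eval_fps_eq[OF g(1) _ g(2), of z] z by simp
qed

lemma heun_local_eq:
  assumes \<kappa>: "\<kappa> \<noteq> 0" "norm \<kappa> < 1" and \<gamma>: "\<gamma> \<notin> \<int>\<^sub>\<le>\<^sub>0"
    and F: "is_local_heun (1 / \<kappa>) (- ((w - \<beta> * \<gamma>) / \<kappa>)) \<alpha> \<beta> \<gamma> (\<beta> + 1) F"
    and z: "z \<in> ball 0 1"
  shows "heun_local (1 / \<kappa>) (- ((w - \<beta> * \<gamma>) / \<kappa>)) \<alpha> \<beta> \<gamma> (\<beta> + 1) z = F z"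
proof -
  let ?P = "is_local_heun (1 / \<kappa>) (- ((w - \<beta> * \<gamma>) / \<kappa>)) \<alpha> \<beta> \<gamma> (\<beta> + 1)"
  \<comment> \<open>Cutting off outside the disk meets the normalization in
    \<open>heun_local\<close> and changes neither the expansion at 0 nor holomorphy in the
    disk.\<close>
  define G where "G z = (if z \<in> ball 0 1 then F z else 0)" for z
  obtain f where f: "F has_fps_expansion f" "F holomorphic_on ball 0 1" "fps_nth f 0 = 1"
    "heun_recurrence \<kappa> w \<alpha> \<beta> \<gamma> (fps_nth f)"
    using F unfolding is_local_heun_iff[OF \<kappa>] by blast
  have "eventually (\<lambda>z. F z = G z) (nhds 0)"
    by (rule eventually_nhds_in_open[of "ball 0 1", THEN eventually_mono]) (auto simp: G_def)
  then have "G has_fps_expansion f"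
    using f(1) has_fps_expansion_cong[of F G f f] by simp
  moreover have "G holomorphic_on ball 0 1"
    using f(2) by (rule holomorphic_transform) (simp add: G_def)
  ultimately have "?P G"
    using f unfolding is_local_heun_iff[OF \<kappa>] by blast
  have "heun_local (1 / \<kappa>) (- ((w - \<beta> * \<gamma>) / \<kappa>)) \<alpha> \<beta> \<gamma> (\<beta> + 1) = G"
    unfolding heun_local_def
  proof (rule the_equality)
    show "?P G \<and> (\<forall>z. z \<notin> ball 0 1 \<longrightarrow> G z = 0)"
      using \<open>?P G\<close> by (simp add: G_def)
    fix H assume H: "?P H \<and> (\<forall>z. z \<notin> ball 0 1 \<longrightarrow> H z = 0)"
    show "H = G"
    proof
      fix z show "H z = G z"
        using is_local_heun_unique[OF \<kappa> \<gamma> _ \<open>?P G\<close>, of H z] H by (cases "z \<in> ball 0 1") (auto simp: G_def)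
    qed
  qed
  then show ?thesis using z by (simp add: G_def)
qed

lemma heun_summand_eq:
  "heun_summand \<alpha> \<beta> \<gamma> k w z n = heun_row \<alpha> \<beta> \<gamma> k w n / fact n * z ^ n"
  by (simp add: heun_summand_def heun_row_def heun_coeff_eq_cancelled atLeast0AtMost
      sum_divide_distrib sum_distrib_right)

theorem theorem5:
  fixes \<alpha> \<beta> \<gamma> \<delta> w :: complex and k :: real
  assumes "\<gamma> \<notin> \<int>\<^sub>\<le>\<^sub>0" and "0 < k" and "k < 1" and "\<delta> = \<beta> + 1"
  shows "(\<forall>z\<in>ball 0 1. summable (heun_summand \<alpha> \<beta> \<gamma> k w z)) \<and>
    is_local_heun (1 / of_real k ^ 2) (- ((w - \<beta> * \<gamma>) / of_real k ^ 2)) \<alpha> \<beta> \<gamma> \<delta>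
      (heun_F \<alpha> \<beta> \<gamma> k w) \<and>
    (\<forall>z\<in>ball 0 1. heun_F \<alpha> \<beta> \<gamma> k w z =
       heun_local (1 / of_real k ^ 2) (- ((w - \<beta> * \<gamma>) / of_real k ^ 2)) \<alpha> \<beta> \<gamma> \<delta> z)"
proof -
  define \<kappa> :: complex where "\<kappa> = of_real k ^ 2"
  have \<kappa>: "\<kappa> \<noteq> 0" "norm \<kappa> < 1"
    using assms by (simp_all add: \<kappa>_def norm_power power_less_one_iff)
  define f where "f = Abs_fps (\<lambda>n. heun_row \<alpha> \<beta> \<gamma> k w n / fact n)"
  have rec: "heun_recurrence \<kappa> w \<alpha> \<beta> \<gamma> (fps_nth f)"
    using heun_row_recurrence[OF assms(1)] by (simp add: f_def \<kappa>_def Abs_fps_inverse)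
  then have rad: "fps_conv_radius f \<ge> 1"
    unfolding fps_conv_radius_def using \<kappa>(2) by (rule heun_recurrence_conv_radius)
  \<comment> \<open>Both sides are the same infinite sum, so they agree as total functions, even at
    points where the series diverges.\<close>
  have F: "heun_F \<alpha> \<beta> \<gamma> k w = eval_fps f"
    by (simp add: fun_eq_iff heun_F_def eval_fps_def f_def heun_summand_eq[abs_def])
  have lt: "norm z < fps_conv_radius f" if "z \<in> ball 0 1" for z
  proof -
    have "ereal (norm z) < 1" using that by simp
    then show ?thesis using rad by (rule less_le_trans)
  qed
  have sum: "\<forall>z\<in>ball 0 1. summable (heun_summand \<alpha> \<beta> \<gamma> k w z)"
    using summable_fps[OF lt] by (simp add: f_def heun_summand_eq[abs_def])
  have "0 < fps_conv_radius f" using lt[of 0] by (simp add: zero_ereal_def)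
  then have "eval_fps f has_fps_expansion f"
    by (rule eval_fps_has_fps_expansion)
  moreover have "eval_fps f holomorphic_on ball 0 1"
    by (rule holomorphic_on_eval_fps) (use lt in auto)
  moreover have "fps_nth f 0 = 1"
    by (simp add: f_def heun_row_0)
  ultimately have "is_local_heun (1 / \<kappa>) (- ((w - \<beta> * \<gamma>) / \<kappa>)) \<alpha> \<beta> \<gamma> (\<beta> + 1) (eval_fps f)"
    unfolding is_local_heun_iff[OF \<kappa>] using rec by blast
  then show ?thesis
    using sum heun_local_eq[OF \<kappa> assms(1)] unfolding F assms(4) \<kappa>_def by metis
qed

end
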